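(* Let $C$ be a convex chain with endpoints $p$ and $q$. If $C$ is contained in the lune $L(p,q)$, then the stretch factor of $C$ is at most $\frac{2\pi}{3}$.
   Context: A chain is a sequence of points $p=c_1,\dots,c_m=q$ together with the segments $c_ic_{i+1}$; it is convex if the polygon $c_1c_2\cdots c_m$ is convex (the points are in convex position and appear in this cyclic order on their convex hull). $L(p,q)$ is the intersection of the two closed disks of radius $|pq|$ centered at $p$ and at $q$. The stretch factor of the chain is the smallest $t$ such that for any two vertices $u,v$ of $C$, the length of the sub-chain of $C$ between $u$ and $v$ is at most $t|uv|$. *)

theory Defs
  imports "HOL-Analysis.Analysis"
begin

text \<open>Points of the plane are complex numbers.  A chain is a list
  [c_0, ..., c_(m-1)] of its vertices; its segments are c_k c_(k+1).\<close>

definition cross :: "complex \<Rightarrow> complex \<Rightarrow> real" where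
  "cross a b = Re a * Im b - Im a * Re b"

text \<open>Convex chain: the polygon c_0 c_1 ... c_(m-1) is convex, i.e. the vertices are
  distinct and, for every (cyclic) edge c_i c_(i+1), all other vertices lie strictly
  on the same side of the line through that edge, with a common orientation s.\<close>
definition convex_chain :: "complex list \<Rightarrow> bool" where
  "convex_chain c \<longleftrightarrow> distinct c \<and>
     (\<exists>s::real. (s = 1 \<or> s = -1) \<and>
       (\<forall>i < length c. \<forall>k < length c. k \<noteq> i \<and> k \<noteq> Suc i mod length c \<longrightarrow>
          s * cross (c ! (Suc i mod length c) - c ! i) (c ! k - c ! i) > 0))"

definition chain_set :: "complex list \<Rightarrow> complex set" where
  "chain_set c = (\<Union>k \<in> {..<length c - 1}. closed_segment (c ! k) (c ! Suc k))"

definition lune :: "complex \<Rightarrow> complex \<Rightarrow> complex set" where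
  "lune p q = cball p (dist p q) \<inter> cball q (dist p q)"

definition subchain_length :: "complex list \<Rightarrow> nat \<Rightarrow> nat \<Rightarrow> real" where
  "subchain_length c i j = (\<Sum>k \<in> {i..<j}. dist (c ! k) (c ! Suc k))"

definition stretch_factor :: "complex list \<Rightarrow> real" where
  "stretch_factor c = Inf {t. \<forall>i j. i < j \<and> j < length c \<longrightarrow>
       subchain_length c i j \<le> t * dist (c ! i) (c ! j)}"

end

theory Submission
  imports Defs
begin

text \<open>
  Normalise \<open>p = 0\<close>, \<open>q = 1\<close> with the chain above \<open>pq\<close>, and write \<open>K = 2\<pi>/3\<close>.  The edge directions
  then decrease within \<open>(-\<pi>/2, \<pi>/2)\<close>, so lengths can be bounded by summation by parts.  This shows that
  the whole chain has length at most \<open>K\<close> and, comparing with a circular sector, that the part up to a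
  vertex \<open>v\<close> has length at most \<open>1 + \<beta> - |vq|\<close>, where \<open>\<beta>\<close> is the angle \<open>pqv\<close>; these two bounds settle all
  pairs containing \<open>p\<close> or \<open>q\<close>.

  For interior vertices \<open>u\<close>, \<open>v\<close>, replace the outer parts of the chain by the segments \<open>pu\<close> and \<open>vq\<close>, and
  minimise \<open>K |xy|\<close> minus the length between \<open>x\<close> and \<open>y\<close> over \<open>x\<close> in \<open>pu\<close> and \<open>y\<close> in \<open>vq\<close>.  At a minimum
  with \<open>x = p\<close> or \<open>y = q\<close> the previous case applies.  At any other minimum, stationarity says that both
  segments, and hence all edges between them, make an angle of cosine at least \<open>1/K\<close> with \<open>xy\<close>;
  projecting onto \<open>xy\<close> bounds the length by \<open>K |xy|\<close>.
\<close>

section \<open>Polar form of plane vectors\<close>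

lemma norm_cis_diff_le: "norm (cis a - cis b) \<le> \<bar>a - b\<bar>"
proof -
  have "cis a - cis b = cis b * (exp (\<i> * of_real (a - b)) - 1)"
    by (simp add: cis_conv_exp algebra_simps flip: exp_add)
  then have "norm (cis a - cis b) = norm (exp (\<i> * of_real (a - b)) - 1)"
    by (simp add: norm_mult)
  also have "\<dots> = 2 * \<bar>sin ((a - b) / 2)\<bar>" by (rule dist_exp_i_1)
  also have "\<dots> \<le> \<bar>a - b\<bar>" using abs_sin_x_le_abs_x[of "(a - b) / 2"] by simp
  finally show ?thesis .
qed

lemma inner_cis_cis: "cis a \<bullet> cis b = cos (a - b)"
  by (simp add: inner_complex_def cos_diff)

lemma cross_rcis: "cross (x *\<^sub>R cis a) (y *\<^sub>R cis b) = x * y * sin (b - a)"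
  by (simp add: cross_def sin_diff algebra_simps)

lemma norm_scaleR_cis_Arg: "norm z *\<^sub>R cis (Arg z) = z"
  using rcis_cmod_Arg[of z] by (simp add: rcis_def scaleR_conv_of_real)

text \<open>In the right half-plane two arguments differ by less than \<open>pi\<close>, so the sign
  of the cross product orders them.\<close>

lemma Arg_less_if_cross_neg:
  assumes "Re a > 0" "Re b > 0" "cross a b < 0"
  shows "Arg b < Arg a"
proof (rule ccontr)
  assume "\<not> Arg b < Arg a"
  moreover have "\<bar>Arg a\<bar> < pi / 2" "\<bar>Arg b\<bar> < pi / 2"
    using assms Arg_Re_pos by blast+
  ultimately have "sin (Arg b - Arg a) \<ge> 0" by (intro sin_ge_zero) auto
  then have "cross (norm a *\<^sub>R cis (Arg a)) (norm b *\<^sub>R cis (Arg b)) \<ge> 0"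
    unfolding cross_rcis by simp
  then show False using assms by (simp only: norm_scaleR_cis_Arg)
qed

section \<open>The critical angle, of cosine 1/K, and the estimate for pairs containing
  \<open>p\<close> or \<open>q\<close>\<close>

lemma cos_arccos_critical: "cos (arccos (3 / (2 * pi))) = 3 / (2 * pi)"
  using pi_approx by (simp add: field_simps)

lemma arccos_critical_nonneg: "0 \<le> arccos (3 / (2 * pi))"
  using pi_approx by (intro arccos_lbound) (auto simp: field_simps)

lemma arccos_critical_le: "arccos (3 / (2 * pi)) \<le> pi / 2"
  using pi_approx by (intro arccos_le_pi2) (auto simp: field_simps)

text \<open>Equivalent to cos (2 pi/3 - 1) \<le> 3/(2 pi), about 0.459 against 0.477, so a Taylor
  bound of degree 4 suffices. It is the case \<open>\<beta> = \<phi>\<close> of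
  \<open>cos_arccos_bound\<close>.\<close>

lemma one_add_arccos_le: "1 + arccos (3 / (2 * pi)) \<le> 2 * pi / 3"
proof -
  define x where "x = 2 * pi / 3 - 1"
  have x: "1.09 < x" "x < 1.1" using pi_approx unfolding x_def by auto
  obtain t where t:
    "cos x = (\<Sum>m<4. cos_coeff m * x ^ m) + cos (t + 1/2 * real 4 * pi) / fact 4 * x ^ 4"
    using Maclaurin_cos_expansion[of x 4] by blast
  have "cos (t + 1/2 * real 4 * pi) / fact 4 * x ^ 4 \<le> 1 / fact 4 * x ^ 4"
    by (intro mult_right_mono divide_right_mono) auto
  then have "cos x \<le> 1 - x\<^sup>2 / 2 + x ^ 4 / 24"
    using t by (simp add: lessThan_nat_numeral cos_coeff_def fact_numeral)
  moreover have "x\<^sup>2 > 1.188" using mult_strict_mono[OF x(1) x(1)] x by (simp add: power2_eq_square)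
  moreover have "x\<^sup>2 < 1.21" using mult_strict_mono[OF x(2) x(2)] x by (simp add: power2_eq_square)
  then have "x ^ 4 < 1.4641"
    using mult_strict_mono[of "x\<^sup>2" "1.21" "x\<^sup>2" "1.21"] by (simp add: eval_nat_numeral)
  ultimately have "cos x < 0.47" by simp
  also have "0.47 < 3 / (2 * pi)" using pi_approx by (simp add: field_simps)
  finally have "arccos (3 / (2 * pi)) \<le> arccos (cos x)"
    using pi_approx by (intro arccos_le_arccos) (auto simp: field_simps)
  also have "arccos (cos x) = x" using x pi_approx by (intro arccos_cos) auto
  finally show ?thesis by (simp add: x_def)
qed

text \<open>The difference of the two sides is convex in \<beta> on this interval, so the endpoints
  decide: it vanishes at 0 because cos \<phi> = 1/K, and at \<phi> it is covered by
  \<open>one_add_arccos_le\<close>.\<close>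

lemma cos_arccos_bound:
  defines "\<phi> \<equiv> arccos (3 / (2 * pi))"
  assumes "0 \<le> \<beta>" "\<beta> \<le> \<phi>"
  shows "1 + \<beta> \<le> 2 * pi / 3 * cos (\<beta> - \<phi>)"
proof -
  have \<phi>: "cos \<phi> = 3 / (2 * pi)" "0 \<le> \<phi>" "\<phi> \<le> pi / 2"
    unfolding \<phi>_def by (fact cos_arccos_critical arccos_critical_nonneg arccos_critical_le)+
  define f where "f = (\<lambda>x. 1 + x - 2 * pi / 3 * cos (x - \<phi>))"
  have "convex_on {0..\<phi>} f" unfolding f_def
  proof (rule f''_ge0_imp_convex)
    show "((\<lambda>x. 1 + x - 2 * pi / 3 * cos (x - \<phi>)) has_real_derivative (1 + 2 * pi / 3 * sin (x - \<phi>))) (at x)" for x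
      by (auto intro!: derivative_eq_intros)
    show "((\<lambda>x. 1 + 2 * pi / 3 * sin (x - \<phi>)) has_real_derivative (2 * pi / 3 * cos (x - \<phi>))) (at x)" for x
      by (auto intro!: derivative_eq_intros)
    show "2 * pi / 3 * cos (x - \<phi>) \<ge> 0" if "x \<in> {0..\<phi>}" for x
      using that \<phi> by (auto intro!: mult_nonneg_nonneg cos_ge_zero)
  qed auto
  moreover have "\<beta> \<in> {0..\<phi>}" using assms by simp
  ultimately have "f \<beta> \<le> max (f 0) (f \<phi>)" by (rule convex_on_le_max)
  also have "\<dots> \<le> 0" using \<phi> one_add_arccos_le by (simp add: f_def flip: \<phi>_def)
  finally show ?thesis by (simp add: f_def)
qed

text \<open>For \<open>t\<close> = |vq| and \<beta> the angle pqv, the norm is |pv|. It is bounded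
  below by projecting onto a unit vector that depends on whether \<beta> exceeds the critical
  angle.\<close>

lemma chord_bound:
  assumes "0 \<le> \<beta>" "\<beta> \<le> pi / 2" "0 \<le> t" "L \<le> 1 + \<beta> - t" "L \<le> 2 * pi / 3 - t"
  shows "L \<le> 2 * pi / 3 * norm (1 - t *\<^sub>R cis \<beta>)"
proof -
  define \<phi> where "\<phi> = arccos (3 / (2 * pi))"
  have \<phi>: "cos \<phi> = 3 / (2 * pi)" "0 \<le> \<phi>" "\<phi> \<le> pi / 2"
    unfolding \<phi>_def by (fact cos_arccos_critical arccos_critical_nonneg arccos_critical_le)+
  have proj: "2 * pi / 3 * ((1 - t *\<^sub>R cis \<beta>) \<bullet> cis \<gamma>) \<le> 2 * pi / 3 * norm (1 - t *\<^sub>R cis \<beta>)" for \<gamma>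
    using norm_cauchy_schwarz[of "1 - t *\<^sub>R cis \<beta>" "cis \<gamma>"] by (intro mult_left_mono) auto
  show ?thesis
  proof (cases "\<beta> \<le> \<phi>")
    case True
    \<comment> \<open>This direction makes the angle \<phi> with \<open>cis \<beta>\<close>, so K
      \<open>* t * cos \<phi>\<close> is exactly \<open>t\<close>.\<close>
    have "(1 - t *\<^sub>R cis \<beta>) \<bullet> cis (\<beta> - \<phi>) = cos (\<beta> - \<phi>) - t * (3 / (2 * pi))"
      using \<phi>(1) inner_cis_cis[of \<beta> "\<beta> - \<phi>"] inner_cis_cis[of 0 "\<beta> - \<phi>"]
      by (simp add: inner_diff_left)
    then have "2 * pi / 3 * ((1 - t *\<^sub>R cis \<beta>) \<bullet> cis (\<beta> - \<phi>)) = 2 * pi / 3 * cos (\<beta> - \<phi>) - t"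
      by (simp only: right_diff_distrib) simp
    then show ?thesis
      using proj[of "\<beta> - \<phi>"] cos_arccos_bound[of \<beta>] True assms by (simp flip: \<phi>_def)
  next
    \<comment> \<open>Beyond the critical angle, projecting onto the direction of pq costs at most
      \<open>t\<close>.\<close>
    case False
    then have "cos \<beta> \<le> 3 / (2 * pi)"
      using \<phi> assms by (subst \<phi>(1)[symmetric], intro cos_monotone_0_pi_le) auto
    then have "2 * pi / 3 * cos \<beta> \<le> 1" by (simp add: field_simps)
    then have "t * (2 * pi / 3 * cos \<beta>) \<le> t * 1" using assms by (intro mult_left_mono)
    moreover have "(1 - t *\<^sub>R cis \<beta>) \<bullet> cis 0 = 1 - t * cos \<beta>"
      by (simp add: inner_complex_def)
    then have "2 * pi / 3 * ((1 - t *\<^sub>R cis \<beta>) \<bullet> cis 0) = 2 * pi / 3 - t * (2 * pi / 3 * cos \<beta>)"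
      by (simp only: right_diff_distrib) simp
    ultimately show ?thesis using proj[of 0] assms by linarith
  qed
qed

section \<open>Minimisation over the two outer segments\<close>

text \<open>First-order condition: for nonzero \<open>w\<close>, the derivative of
  \<open>K * norm\<close> along \<open>d\<close> is at least 1. Stated without division, it also
  covers \<open>w = 0\<close>, where the norm is not differentiable.\<close>

lemma inner_ge_if_norm_growth:
  fixes w d :: "'a::real_inner"
  assumes "norm d = 1" "K > 0" "t > 0"
    and growth: "\<And>e. 0 < e \<Longrightarrow> e \<le> t \<Longrightarrow> e \<le> K * norm (w + e *\<^sub>R d) - K * norm w"
  shows "norm w \<le> K * (w \<bullet> d)"
proof (rule ccontr)
  assume "\<not> ?thesis"
  then have neg: "w \<bullet> d < norm w / K" using \<open>K > 0\<close> by (simp add: field_simps)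
  \<comment> \<open>Capped by the gap, \<open>e\<close> has a square too small to make up for the
    linear deficit of \<open>2 * e\<close> times the gap.\<close>
  define e where "e = min t (norm w / K - w \<bullet> d)"
  have e: "0 < e" "e \<le> t" "e \<le> norm w / K - w \<bullet> d" using neg \<open>t > 0\<close> unfolding e_def by auto
  have "norm w + e / K \<le> norm (w + e *\<^sub>R d)"
    using growth[OF e(1,2)] \<open>K > 0\<close> by (simp add: field_simps)
  then have "(norm w + e / K)\<^sup>2 \<le> (norm (w + e *\<^sub>R d))\<^sup>2"
    using e \<open>K > 0\<close> by (intro power_mono) auto
  also have "\<dots> = (norm w)\<^sup>2 + 2 * e * (w \<bullet> d) + e\<^sup>2"
    using \<open>norm d = 1\<close>[unfolded norm_eq_1]
    unfolding power2_norm_eq_inner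
    by (simp add: inner_add inner_commute power2_eq_square algebra_simps)
  also have "(norm w + e / K)\<^sup>2 = (norm w)\<^sup>2 + 2 * e * (norm w / K) + (e / K)\<^sup>2"
    by (simp add: power2_sum)
  finally have "2 * e * (norm w / K) \<le> 2 * e * (w \<bullet> d) + e * e"
    using zero_le_power2[of "e / K"] unfolding power2_eq_square by linarith
  then have "e * (2 * (norm w / K)) \<le> e * (2 * (w \<bullet> d) + e)" by (simp add: algebra_simps)
  then have "2 * (norm w / K) \<le> 2 * (w \<bullet> d) + e" using e(1) by (rule mult_left_le_imp_le)
  then show False using e neg by linarith
qed

lemma middle_bound:
  fixes a s M \<alpha> \<beta> :: real
  defines "D \<equiv> 1 - a *\<^sub>R cis \<alpha> - s *\<^sub>R cis (- \<beta>)"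
  assumes a: "0 \<le> a" "0 \<le> \<alpha>" "\<alpha> \<le> pi / 2" "0 < a \<Longrightarrow> \<alpha> < pi / 2"
    and s: "0 \<le> s" "0 \<le> \<beta>" "\<beta> \<le> pi / 2" "0 < s \<Longrightarrow> \<beta> < pi / 2"
    and bounds: "a + M \<le> 1 + \<beta> - s" "M + s \<le> 1 + \<alpha> - a" "a + M + s \<le> 2 * pi / 3"
    and cone: "\<And>n. 1 \<le> cis \<alpha> \<bullet> n \<Longrightarrow> 1 \<le> cis (- \<beta>) \<bullet> n \<Longrightarrow> M \<le> D \<bullet> n"
  shows "M \<le> 2 * pi / 3 * norm D"
proof -
  define K where "K = 2 * pi / 3"
  have K: "K > 0" by (simp add: K_def)
  \<comment> \<open>\<open>W z\<close> is y - x for x on pu at distance \<open>fst z\<close> from p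
    and y on vq at distance \<open>snd z\<close> from q; \<open>F z\<close> is K |xy| minus the
    length between them.\<close>
  define W where "W = (\<lambda>z. 1 - fst z *\<^sub>R cis \<alpha> - snd z *\<^sub>R cis (- \<beta>))"
  define F where "F = (\<lambda>z. K * norm (W z) - (a - fst z) - M - (s - snd z))"
  have "compact ({0..a} \<times> {0..s})" "{0..a} \<times> {0..s} \<noteq> {}" using a s by (auto intro: compact_Times)
  moreover have "continuous_on ({0..a} \<times> {0..s}) F"
    unfolding F_def W_def by (intro continuous_intros)
  ultimately obtain z where z: "z \<in> {0..a} \<times> {0..s}"
    and min: "\<And>y. y \<in> {0..a} \<times> {0..s} \<Longrightarrow> F z \<le> F y"
    using continuous_attains_inf[of "{0..a} \<times> {0..s}" F] by blast
  obtain t t' where [simp]: "z = (t, t')" by (cases z)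
  have t: "0 \<le> t" "t \<le> a" "0 \<le> t'" "t' \<le> s" using z by auto
  have "0 \<le> F z"
  proof (cases "t = 0 \<or> t' = 0")
    case True
    then show ?thesis
    proof
      assume "t = 0"
      \<comment> \<open>Reflection in the line pq brings this case into the form of
        \<open>chord_bound\<close>.\<close>
      have "norm (1 - t' *\<^sub>R cis (- \<beta>)) = norm (1 - t' *\<^sub>R cis \<beta>)"
        by (metis complex_mod_cnj complex_cnj_diff complex_cnj_one complex_cnj_scaleR cis_cnj)
      with \<open>t = 0\<close> show ?thesis using chord_bound[of \<beta> t' "a + M + s - t'"] s t bounds
        by (simp add: F_def W_def K_def)
    next
      assume "t' = 0"
      then show ?thesis using chord_bound[of \<alpha> t "a + M + s - t"] a t bounds
        by (simp add: F_def W_def K_def)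
    qed
  next
    case False
    then have pos: "t > 0" "t' > 0" "\<alpha> < pi / 2" "\<beta> < pi / 2" using t a s by auto
    define w where "w = W z"
    \<comment> \<open>Only a decrease of \<open>t\<close> is compared, so minima with
      \<open>t = a\<close> need no separate treatment.\<close>
    have alpha: "norm w \<le> K * (w \<bullet> cis \<alpha>)"
    proof (rule inner_ge_if_norm_growth[OF _ K pos(1)])
      fix e assume e: "0 < e" "e \<le> t"
      have "W (t - e, t') = w + e *\<^sub>R cis \<alpha>" by (simp add: w_def W_def algebra_simps)
      then show "e \<le> K * norm (w + e *\<^sub>R cis \<alpha>) - K * norm w"
        using min[of "(t - e, t')"] e t by (simp add: F_def w_def)
    qed simp
    have beta: "norm w \<le> K * (w \<bullet> cis (- \<beta>))"
    proof (rule inner_ge_if_norm_growth[OF _ K pos(2)])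
      fix e assume e: "0 < e" "e \<le> t'"
      have "W (t, t' - e) = w + e *\<^sub>R cis (- \<beta>)" by (simp add: w_def W_def algebra_simps)
      then show "e \<le> K * norm (w + e *\<^sub>R cis (- \<beta>)) - K * norm w"
        using min[of "(t, t' - e)"] e t by (simp add: F_def w_def)
    qed simp
    \<comment> \<open>For \<open>w \<noteq> 0\<close> the vector is \<open>w\<close> rescaled to
      norm K, by stationarity. For \<open>w = 0\<close> any \<open>n\<close> with the first two
      properties will do, and a large positive real has them as both angles are acute.\<close>
    obtain n where n: "1 \<le> cis \<alpha> \<bullet> n" "1 \<le> cis (- \<beta>) \<bullet> n" "w \<bullet> n \<le> K * norm w"
    proof (cases "w = 0")
      case True
      have c: "cos \<alpha> > 0" "cos \<beta> > 0" using pos a s by (auto intro!: cos_gt_zero_pi)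
      define n :: complex where "n = of_real (1 / min (cos \<alpha>) (cos \<beta>))"
      have "1 \<le> cis \<alpha> \<bullet> n" "1 \<le> cis (- \<beta>) \<bullet> n"
        using c unfolding n_def by (auto simp: inner_complex_def min_def)
      with that True show ?thesis by auto
    next
      case False
      show ?thesis
        by (rule that[of "(K / norm w) *\<^sub>R w"])
          (use False alpha beta in \<open>auto simp: field_simps inner_commute dot_square_norm power2_eq_square\<close>)
    qed
    have "(a - t) + M + (s - t') \<le> (a - t) * (cis \<alpha> \<bullet> n) + D \<bullet> n + (s - t') * (cis (- \<beta>) \<bullet> n)"
      using cone[OF n(1,2)] mult_left_mono[OF n(1), of "a - t"] mult_left_mono[OF n(2), of "s - t'"] t
      by simp
    also have "\<dots> = w \<bullet> n"
      by (simp add: w_def W_def D_def inner_diff_left algebra_simps)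
    finally show ?thesis using n(3) by (simp add: F_def w_def)
  qed
  also have "F z \<le> F (a, s)" using a s by (intro min) auto
  finally show ?thesis by (simp add: F_def W_def D_def K_def)
qed

section \<open>Unit vectors in a quadrant or a sector\<close>

lemma one_le_sin_add_cos:
  assumes "0 \<le> x" "x \<le> pi / 2"
  shows "1 \<le> sin x + cos x"
proof -
  have "0 \<le> sin x" "0 \<le> cos x" using assms by (auto intro!: sin_ge_zero cos_ge_zero)
  then have "sin x * sin x \<le> sin x * 1" "cos x * cos x \<le> cos x * 1"
    by (intro mult_left_mono; simp)+
  then show ?thesis using sin_cos_squared_add[of x] by (simp add: power2_eq_square)
qed

text \<open>An arc lies beyond its chord: \<open>cis x\<close> is a nonnegative combination of
  \<open>cis a\<close> and \<open>cis b\<close>, with coefficients \<open>sin (x - b)\<close> and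
  \<open>sin (a - x)\<close> over \<open>sin (a - b)\<close>, whose sum is at least 1.\<close>

lemma inner_cis_sector_ge_1:
  assumes "b \<le> x" "x \<le> a" "a - b < pi"
    and "1 \<le> cis a \<bullet> n" "1 \<le> cis b \<bullet> n"
  shows "1 \<le> cis x \<bullet> n"
proof (cases "a = b")
  case True
  then show ?thesis using assms by simp
next
  case False
  then have pos: "sin (a - b) > 0" using assms by (intro sin_gt_zero) auto
  have nonneg: "0 \<le> sin (x - b)" "0 \<le> sin (a - x)" using assms by (auto intro!: sin_ge_zero)
  have "sin (a - b) = sin (x - b) * cos (a - x) + cos (x - b) * sin (a - x)"
    by (simp flip: sin_add)
  also have "\<dots> \<le> sin (x - b) * 1 + 1 * sin (a - x)"
    using nonneg by (intro add_mono mult_left_mono mult_right_mono) auto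
  also have "\<dots> \<le> sin (x - b) * (cis a \<bullet> n) + sin (a - x) * (cis b \<bullet> n)"
    using nonneg assms mult_left_mono[of 1 "cis a \<bullet> n" "sin (x - b)"]
      mult_left_mono[of 1 "cis b \<bullet> n" "sin (a - x)"] by simp
  also have "\<dots> = (sin (x - b) *\<^sub>R cis a + sin (a - x) *\<^sub>R cis b) \<bullet> n"
    by (simp add: inner_add_left)
  also have "sin (x - b) *\<^sub>R cis a + sin (a - x) *\<^sub>R cis b = sin (a - b) *\<^sub>R cis x"
  proof (rule complex_eqI)
    show "Re (sin (x - b) *\<^sub>R cis a + sin (a - x) *\<^sub>R cis b) = Re (sin (a - b) *\<^sub>R cis x)"
      by (simp add: sin_diff algebra_simps)
    show "Im (sin (x - b) *\<^sub>R cis a + sin (a - x) *\<^sub>R cis b) = Im (sin (a - b) *\<^sub>R cis x)"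
      by (simp add: sin_diff algebra_simps)
  qed
  finally show ?thesis using pos by simp
qed

section \<open>Normalised chains and their edge directions\<close>

text \<open>Normal form of the chain: p = 0, q = 1, traversed clockwise above pq. Of convexity it
  keeps only the position of each edge relative to p, q and the next vertex. Values of
  \<open>c\<close> beyond \<open>m\<close> are irrelevant.\<close>

locale unit_lune_chain =
  fixes c :: "nat \<Rightarrow> complex" and m :: nat
  assumes start: "c 0 = 0" and finish: "c m = 1"
    and norm_le_1: "k \<le> m \<Longrightarrow> norm (c k) \<le> 1"
    and norm_diff_le_1: "k \<le> m \<Longrightarrow> norm (c k - 1) \<le> 1"
    and Im_pos: "0 < k \<Longrightarrow> k < m \<Longrightarrow> 0 < Im (c k)"
    and start_side: "0 < k \<Longrightarrow> k < m \<Longrightarrow> cross (c k) (c (Suc k) - c k) < 0"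
    and finish_side: "Suc k < m \<Longrightarrow> cross (c (Suc k) - c k) (1 - c (Suc k)) < 0"
    and turn: "Suc k < m \<Longrightarrow>
      cross (c (Suc k) - c k) (c (Suc (Suc k)) - c (Suc k)) < 0"
begin

definition dir :: "nat \<Rightarrow> real" where
  "dir k = Arg (c (Suc k) - c k)"

definition len :: "nat \<Rightarrow> nat \<Rightarrow> real" where
  "len i j = (\<Sum>k \<in> {i..<j}. dist (c k) (c (Suc k)))"

lemma len_refl [simp]: "len i i = 0"
  by (simp add: len_def)

lemma len_Suc: "i \<le> j \<Longrightarrow> len i (Suc j) = len i j + dist (c j) (c (Suc j))"
  by (simp add: len_def)

lemma len_add: "i \<le> j \<Longrightarrow> j \<le> k \<Longrightarrow> len i j + len j k = len i k"
  unfolding len_def by (rule sum.atLeastLessThan_concat)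

lemma dist_le_len: "i \<le> j \<Longrightarrow> dist (c i) (c j) \<le> len i j"
proof (induction j rule: dec_induct)
  case (step n)
  then show ?case using dist_triangle[of "c i" "c (Suc n)" "c n"] by (simp add: len_Suc)
qed simp

lemma Re_interior:
  assumes "0 < k" "k < m"
  shows "0 < Re (c k)" "Re (c k) < 1"
proof -
  have "(Re (c k) - 1)\<^sup>2 + (Im (c k))\<^sup>2 \<le> 1" "(Re (c k))\<^sup>2 + (Im (c k))\<^sup>2 \<le> 1"
    using norm_diff_le_1[of k] norm_le_1[of k] assms by (auto simp: cmod_def)
  moreover have "0 < (Im (c k))\<^sup>2" using Im_pos[OF assms] by simp
  ultimately have "(Re (c k) - 1)\<^sup>2 < 1" "(Re (c k))\<^sup>2 < 1" by linarith+
  then show "0 < Re (c k)" "Re (c k) < 1"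
    by (simp_all add: power2_less_1_iff)
qed

text \<open>An edge not pointing right would have to point down by \<open>start_side\<close>, and
  then q would lie on the wrong side of it, against \<open>finish_side\<close>.\<close>

lemma Re_edge_pos:
  assumes "k < m"
  shows "0 < Re (c (Suc k) - c k)"
proof (cases "k = 0 \<or> Suc k = m")
  case True
  then show ?thesis using assms Re_interior[of 1] Re_interior[of k] start finish
    by (cases "k = 0"; cases "Suc k = m") auto
next
  case False
  define x y ex ey where [simp]: "x = Re (c k)" "y = Im (c k)"
    "ex = Re (c (Suc k) - c k)" "ey = Im (c (Suc k) - c k)"
  have pos: "0 < x" "x < 1" "0 < y"
    using False assms Re_interior[of k] Im_pos[of k] by auto
  have A: "x * ey - y * ex < 0" using start_side[of k] False assms by (simp add: cross_def)
  have B: "- (ex * y) - ey * (1 - x) < 0"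
    using finish_side[of k] False assms by (simp add: cross_def algebra_simps)
  show ?thesis
  proof (rule ccontr)
    assume "\<not> ?thesis"
    then have "ex * y \<le> 0" using pos by (auto intro!: mult_nonpos_nonneg)
    with A have "x * ey < 0" by (simp add: mult.commute)
    then have "ey < 0" using pos by (simp add: mult_less_0_iff)
    then have "ey * (1 - x) \<le> 0" using pos by (intro mult_nonpos_nonneg) auto
    with \<open>ex * y \<le> 0\<close> B show False by linarith
  qed
qed

lemma abs_dir_less: "k < m \<Longrightarrow> \<bar>dir k\<bar> < pi / 2"
  unfolding dir_def using Re_edge_pos Arg_Re_pos by blast

lemma edge: "c (Suc k) - c k = dist (c k) (c (Suc k)) *\<^sub>R cis (dir k)"
  unfolding dir_def dist_norm by (subst norm_minus_commute) (rule norm_scaleR_cis_Arg[symmetric])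

lemma dir_antimono: "k \<le> l \<Longrightarrow> l < m \<Longrightarrow> dir l \<le> dir k"
proof (induction l rule: dec_induct)
  case (step n)
  then have "dir (Suc n) < dir n"
    unfolding dir_def by (intro Arg_less_if_cross_neg Re_edge_pos turn) auto
  with step show ?case by simp
qed simp

section \<open>Length bounds by summation by parts and by projection\<close>

text \<open>Summation by parts: with decreasing directions, the sum of the inner products of the edges
  with their own directions turns into boundary terms plus inner products of the vertices with
  differences of directions, and the latter add up to at most the total turning angle.\<close>
lemma len_le_turning:
  assumes "i \<le> j" "j \<le> m" "z \<in> {0, 1}"
    and "\<And>k. i \<le> k \<Longrightarrow> k < j \<Longrightarrow> \<tau> \<le> dir k \<and> dir k \<le> \<sigma>" and "\<tau> \<le> \<sigma>"
  shows "len i j \<le> (c j - z) \<bullet> cis \<tau> - (c i - z) \<bullet> cis \<sigma> + (\<sigma> - \<tau>)"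
  using assms
proof (induction j arbitrary: \<tau> rule: dec_induct)
  case base
  have "(c i - z) \<bullet> (cis \<sigma> - cis \<tau>) \<le> norm (c i - z) * norm (cis \<sigma> - cis \<tau>)"
    by (rule norm_cauchy_schwarz)
  \<comment> \<open>The lune enters here: every vertex is within distance 1 of both values of
    \<open>z\<close>.\<close>
  also have "\<dots> \<le> 1 * \<bar>\<sigma> - \<tau>\<bar>"
    using base norm_le_1[of i] norm_diff_le_1[of i] by (intro mult_mono norm_cis_diff_le) auto
  finally show ?case using base by (simp add: inner_diff_right)
next
  case (step n)
  define r where "r = dist (c n) (c (Suc n))"
  \<comment> \<open>The induction hypothesis takes \<open>dir n\<close> as its lower bound; the
    remaining turn from \<open>dir n\<close> to \<tau> is charged to the vertex
    \<open>c (Suc n)\<close>.\<close>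
  have "len i n \<le> (c n - z) \<bullet> cis (dir n) - (c i - z) \<bullet> cis \<sigma> + (\<sigma> - dir n)"
    using step by (intro step.IH) (auto intro: dir_antimono)
  moreover have "r = (c (Suc n) - c n) \<bullet> cis (dir n)"
    unfolding edge r_def by (simp add: inner_cis_cis)
  moreover have "(c (Suc n) - z) \<bullet> (cis (dir n) - cis \<tau>) \<le> dir n - \<tau>"
  proof -
    have "(c (Suc n) - z) \<bullet> (cis (dir n) - cis \<tau>)
        \<le> norm (c (Suc n) - z) * norm (cis (dir n) - cis \<tau>)"
      by (rule norm_cauchy_schwarz)
    also have "\<dots> \<le> 1 * \<bar>dir n - \<tau>\<bar>"
      using step norm_le_1[of "Suc n"] norm_diff_le_1[of "Suc n"]
      by (intro mult_mono norm_cis_diff_le) auto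
    finally show ?thesis using step by simp
  qed
  ultimately show ?case
    using step.hyps by (simp add: len_Suc inner_diff_right inner_diff_left flip: r_def)
qed

text \<open>Each edge is at most as long as its inner product with \<open>n\<close>, and these
  products telescope.\<close>

lemma len_le_inner:
  assumes "i \<le> j" and "\<And>k. i \<le> k \<Longrightarrow> k < j \<Longrightarrow> 1 \<le> cis (dir k) \<bullet> n"
  shows "len i j \<le> (c j - c i) \<bullet> n"
  using assms
proof (induction j rule: dec_induct)
  case (step l)
  have "dist (c l) (c (Suc l)) * 1 \<le> dist (c l) (c (Suc l)) * (cis (dir l) \<bullet> n)"
    using step by (intro mult_left_mono) auto
  also have "\<dots> = (c (Suc l) - c l) \<bullet> n" unfolding edge by simp
  finally show ?case using step by (simp add: len_Suc inner_diff_left)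
qed simp

lemma split_at_direction:
  assumes "i \<le> j" "j \<le> m"
  obtains k where "i \<le> k" "k \<le> j" "\<And>l. i \<le> l \<Longrightarrow> l < k \<Longrightarrow> \<tau> \<le> dir l"
    "\<And>l. k \<le> l \<Longrightarrow> l < j \<Longrightarrow> dir l \<le> \<tau>"
  using assms
proof (induction j arbitrary: thesis rule: dec_induct)
  case (step n)
  show ?case
  proof (cases "\<tau> \<le> dir n")
    case True
    then show ?thesis using step.prems step.hyps dir_antimono
      by (intro step.prems(1)[of "Suc n"]) (auto intro: order_trans)
  next
    case False
    obtain k where "i \<le> k" "k \<le> n" "\<And>l. i \<le> l \<Longrightarrow> l < k \<Longrightarrow> \<tau> \<le> dir l"
      "\<And>l. k \<le> l \<Longrightarrow> l < n \<Longrightarrow> dir l \<le> \<tau>"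
      using step.IH step.prems(2) by (metis Suc_leD)
    with False show ?thesis by (intro step.prems(1)[of k]) (auto simp: less_Suc_eq)
  qed
qed auto

text \<open>The bound is the length of a path around a sector: from p along the unit circle about q
  through the angle \<beta>, then down the radius to \<open>c j\<close>. The tangent at the end of
  the arc has direction \<tau>. Steeper edges are compared with the arc by
  \<open>len_le_turning\<close> with \<open>z = 1\<close>; the others lie in the quadrant between
  \<open>cis \<tau>\<close> and \<open>cis (- \<beta>)\<close> and are bounded by the sum of their
  components.\<close>

lemma len_from_start:
  assumes "j \<le> m" "0 \<le> s" "0 \<le> \<beta>" "\<beta> \<le> pi / 2" "1 - c j = s *\<^sub>R cis (- \<beta>)"
    and "\<And>k. k < j \<Longrightarrow> - \<beta> \<le> dir k"
  shows "len 0 j \<le> 1 + \<beta> - s"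
proof -
  define \<tau> where "\<tau> = pi / 2 - \<beta>"
  obtain k where k: "k \<le> j" "\<And>l. l < k \<Longrightarrow> \<tau> \<le> dir l"
    "\<And>l. k \<le> l \<Longrightarrow> l < j \<Longrightarrow> dir l \<le> \<tau>"
    by (rule split_at_direction[of 0 j \<tau>]) (use assms in \<open>blast intro: le0\<close>)+
  have "len 0 k \<le> (c k - 1) \<bullet> cis \<tau> - (c 0 - 1) \<bullet> cis (pi / 2) + (pi / 2 - \<tau>)"
  proof (rule len_le_turning)
    show "\<tau> \<le> dir l \<and> dir l \<le> pi / 2" if "0 \<le> l" "l < k" for l
      using k(1) k(2)[of l] abs_dir_less[of l] assms(1) that by auto
  qed (use k assms in \<open>auto simp: \<tau>_def\<close>)
  then have "len 0 k \<le> (c k - 1) \<bullet> cis \<tau> + \<beta>"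
    by (simp add: start inner_complex_def \<tau>_def)
  moreover have "len k j \<le> (c j - c k) \<bullet> (cis \<tau> + cis (- \<beta>))"
  proof (rule len_le_inner)
    fix l assume l: "k \<le> l" "l < j"
    have "cis (dir l) \<bullet> (cis \<tau> + cis (- \<beta>)) = sin (dir l + \<beta>) + cos (dir l + \<beta>)"
    proof -
      have "dir l - \<tau> = - (pi / 2 - (dir l + \<beta>))" by (simp add: \<tau>_def)
      then have "cos (dir l - \<tau>) = sin (dir l + \<beta>)"
        by (simp only: cos_minus sin_cos_eq of_real_eq_id id_apply)
      then show ?thesis by (simp add: inner_add_right inner_cis_cis)
    qed
    also have "1 \<le> \<dots>" using k(3)[OF l] assms(6)[OF l(2)]
      by (intro one_le_sin_add_cos) (auto simp: \<tau>_def)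
    finally show "1 \<le> cis (dir l) \<bullet> (cis \<tau> + cis (- \<beta>))" .
  qed (use k in auto)
  moreover have "(1 - c j) \<bullet> cis \<tau> = 0" "(1 - c j) \<bullet> cis (- \<beta>) = s"
    unfolding assms(5) by (simp_all add: inner_cis_cis \<tau>_def)
  moreover have "(1 - c k) \<bullet> cis (- \<beta>) \<le> 1"
    using norm_cauchy_schwarz[of "1 - c k" "cis (- \<beta>)"] norm_diff_le_1[of k] k assms
    by (simp add: norm_minus_commute)
  moreover have "len 0 j = len 0 k + len k j" using k by (simp add: len_add)
  ultimately show ?thesis
    by (simp add: inner_diff_left inner_add_right)
qed

text \<open>Mirror image of \<open>len_from_start\<close>, with the sector centred at p.\<close>

lemma len_to_finish:
  assumes "i \<le> m" "0 \<le> a" "0 \<le> \<alpha>" "\<alpha> \<le> pi / 2" "c i = a *\<^sub>R cis \<alpha>"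
    and "\<And>k. i \<le> k \<Longrightarrow> k < m \<Longrightarrow> dir k \<le> \<alpha>"
  shows "len i m \<le> 1 + \<alpha> - a"
proof -
  define \<tau> where "\<tau> = \<alpha> - pi / 2"
  obtain k where k: "i \<le> k" "k \<le> m" "\<And>l. i \<le> l \<Longrightarrow> l < k \<Longrightarrow> \<tau> \<le> dir l"
    "\<And>l. k \<le> l \<Longrightarrow> l < m \<Longrightarrow> dir l \<le> \<tau>"
    by (rule split_at_direction[of i m \<tau>]) (use assms in blast)+
  have "len k m \<le> (c m - 0) \<bullet> cis (- (pi / 2)) - (c k - 0) \<bullet> cis \<tau> + (\<tau> - - (pi / 2))"
  proof (rule len_le_turning)
    show "- (pi / 2) \<le> dir l \<and> dir l \<le> \<tau>" if "k \<le> l" "l < m" for l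
      using k(4)[of l] abs_dir_less[of l] that by auto
  qed (use k assms in \<open>auto simp: \<tau>_def\<close>)
  then have "len k m \<le> \<alpha> - c k \<bullet> cis \<tau>"
    by (simp add: finish inner_complex_def \<tau>_def)
  moreover have "len i k \<le> (c k - c i) \<bullet> (cis \<alpha> + cis \<tau>)"
  proof (rule len_le_inner)
    fix l assume l: "i \<le> l" "l < k"
    have "cis (dir l) \<bullet> (cis \<alpha> + cis \<tau>) = sin (\<alpha> - dir l) + cos (\<alpha> - dir l)"
    proof -
      have "dir l - \<tau> = pi / 2 - (\<alpha> - dir l)" by (simp add: \<tau>_def)
      then have "cos (dir l - \<tau>) = sin (\<alpha> - dir l)" by (simp only: sin_cos_eq of_real_eq_id id_apply)
      moreover have "cos (dir l - \<alpha>) = cos (\<alpha> - dir l)" by (simp flip: cos_minus[of "\<alpha> - dir l"])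
      ultimately show ?thesis by (simp add: inner_add_right inner_cis_cis)
    qed
    also have "1 \<le> \<dots>" using k(2) k(3)[OF l] assms(6)[OF l(1)] l
      by (intro one_le_sin_add_cos) (auto simp: \<tau>_def)
    finally show "1 \<le> cis (dir l) \<bullet> (cis \<alpha> + cis \<tau>)" .
  qed (use k in auto)
  moreover have "c i \<bullet> cis \<tau> = 0" "c i \<bullet> cis \<alpha> = a"
    unfolding assms(5) by (simp_all add: inner_cis_cis \<tau>_def)
  moreover have "c k \<bullet> cis \<alpha> \<le> 1"
    using norm_cauchy_schwarz[of "c k" "cis \<alpha>"] norm_le_1[of k] k by simp
  moreover have "len i m = len i k + len k m" using k by (simp add: len_add)
  ultimately show ?thesis
    by (simp add: inner_diff_left inner_add_right)
qed

text \<open>The extremal curve is the upper boundary of the lune, two unit arcs of angle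
  \<open>pi / 3\<close>. The tangent falls from \<open>pi / 2\<close> to \<open>pi / 6\<close> on
  the first and from \<open>- (pi / 6)\<close> to \<open>- (pi / 2)\<close> on the second;
  directions in between belong to the corner at the apex.\<close>

lemma len_total: "len 0 m \<le> 2 * pi / 3"
proof -
  obtain k where k: "k \<le> m" "\<And>l. l < k \<Longrightarrow> pi / 6 \<le> dir l"
    "\<And>l. k \<le> l \<Longrightarrow> l < m \<Longrightarrow> dir l \<le> pi / 6"
    by (rule split_at_direction[of 0 m "pi / 6"]) (blast intro: le0)+
  obtain l where l: "k \<le> l" "l \<le> m" "\<And>h. k \<le> h \<Longrightarrow> h < l \<Longrightarrow> - (pi / 6) \<le> dir h"
    "\<And>h. l \<le> h \<Longrightarrow> h < m \<Longrightarrow> dir h \<le> - (pi / 6)"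
    by (rule split_at_direction[of k m "- (pi / 6)"]) (use k(1) in blast)+
  define p P where "p = sqrt 3 * Re (c k)" and "P = sqrt 3 * Re (c l)"
  have "len 0 k \<le> (c k - 1) \<bullet> cis (pi / 6) - (c 0 - 1) \<bullet> cis (pi / 2) + (pi / 2 - pi / 6)"
  proof (rule len_le_turning)
    show "pi / 6 \<le> dir l \<and> dir l \<le> pi / 2" if "0 \<le> l" "l < k" for l
      using k(1) k(2)[of l] abs_dir_less[of l] that by auto
  qed (use k in auto)
  then have "len 0 k \<le> (p - sqrt 3 + Im (c k)) / 2 + pi / 3"
    by (simp add: start inner_complex_def cos_30 sin_30 p_def field_simps)
  moreover
  have "len l m \<le> (c m - 0) \<bullet> cis (- (pi / 2)) - (c l - 0) \<bullet> cis (- (pi / 6))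
      + (- (pi / 6) - - (pi / 2))"
  proof (rule len_le_turning)
    show "- (pi / 2) \<le> dir h \<and> dir h \<le> - (pi / 6)" if "l \<le> h" "h < m" for h
      using l(4)[of h] abs_dir_less[of h] that by auto
  qed (use l in auto)
  then have "len l m \<le> (Im (c l) - P) / 2 + pi / 3"
    by (simp add: finish inner_complex_def cos_30 sin_30 P_def field_simps)
  moreover
  \<comment> \<open>The factor is 1 / cos (pi/6).\<close>
  have "len k l \<le> (c l - c k) \<bullet> of_real (2 * sqrt 3 / 3)"
  proof (rule len_le_inner)
    fix h assume h: "k \<le> h" "h < l"
    have "cos (pi / 6) \<le> cos \<bar>dir h\<bar>"
      using k(3)[of h] l(3)[of h] h l(2) by (intro cos_monotone_0_pi_le) auto
    then have "sqrt 3 / 2 \<le> cos (dir h)" by (simp add: cos_30)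
    then have "sqrt 3 / 2 * (2 * sqrt 3 / 3) \<le> cos (dir h) * (2 * sqrt 3 / 3)"
      by (intro mult_right_mono) auto
    then show "1 \<le> cis (dir h) \<bullet> of_real (2 * sqrt 3 / 3)"
      by (simp add: inner_complex_def)
  qed (use l in auto)
  then have "len k l \<le> 2 * (P - p) / 3"
    by (simp add: inner_complex_def p_def P_def field_simps)
  \<comment> \<open>These are the unit vectors from q and from p to the apex of the lune; the two
    disks bound the vertices in these directions.\<close>
  moreover have "(c k - 1) \<bullet> cis (2 * pi / 3) \<le> 1" "c l \<bullet> cis (pi / 3) \<le> 1"
    using norm_cauchy_schwarz[of "c k - 1" "cis (2 * pi / 3)"] norm_diff_le_1[of k]
      norm_cauchy_schwarz[of "c l" "cis (pi / 3)"] norm_le_1[of l] k l by auto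
  then have "sqrt 3 * ((c k - 1) \<bullet> cis (2 * pi / 3) + c l \<bullet> cis (pi / 3)) \<le> sqrt 3 * 2"
    by (intro mult_left_mono) auto
  then have "(P - p) / 6 + (Im (c k) + Im (c l)) / 2 \<le> sqrt 3 / 2"
    by (simp add: inner_complex_def cos_60 sin_60 cos_120' sin_120' p_def P_def field_simps)
  moreover have "len 0 m = len 0 k + len k l + len l m" using k l by (simp add: len_add)
  ultimately show ?thesis by argo
qed

section \<open>Stretch of an arbitrary pair in a normalised chain\<close>

lemma direction_from_start:
  assumes "i < m"
  obtains a \<alpha> where "0 \<le> a" "0 \<le> \<alpha>" "\<alpha> \<le> pi / 2" "0 < a \<Longrightarrow> \<alpha> < pi / 2" "c i = a *\<^sub>R cis \<alpha>"
    "\<And>k. i \<le> k \<Longrightarrow> k < m \<Longrightarrow> dir k \<le> \<alpha>"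
proof (cases "i = 0")
  case True
  \<comment> \<open>For \<open>i = 0\<close> the segment is degenerate and \<open>pi / 2\<close>
    serves as a default above all edge directions.\<close>
  then show ?thesis using that[of 0 "pi / 2"] abs_dir_less start by fastforce
next
  case False
  have "Arg (c (Suc i) - c i) < Arg (c i)"
    using False assms by (intro Arg_less_if_cross_neg Re_interior Re_edge_pos start_side) auto
  then have "dir k \<le> Arg (c i)" if "i \<le> k" "k < m" for k
    using dir_antimono[OF that] by (simp add: dir_def)
  moreover have "\<bar>Arg (c i)\<bar> < pi / 2" "0 \<le> Arg (c i)"
    using False assms Re_interior[of i] Im_pos[of i] Arg_Re_pos[of "c i"] Arg_less_0[of "c i"]
    by (auto intro: less_imp_le)
  ultimately show ?thesis
    using that[of "norm (c i)" "Arg (c i)"] norm_scaleR_cis_Arg[of "c i"] by auto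
qed

lemma direction_to_finish:
  assumes "0 < j" "j \<le> m"
  obtains s \<beta> where "0 \<le> s" "0 \<le> \<beta>" "\<beta> \<le> pi / 2" "0 < s \<Longrightarrow> \<beta> < pi / 2"
    "1 - c j = s *\<^sub>R cis (- \<beta>)" "\<And>k. k < j \<Longrightarrow> - \<beta> \<le> dir k"
proof (cases "j = m")
  case True
  then show ?thesis using that[of 0 "pi / 2"] abs_dir_less finish by fastforce
next
  case False
  then obtain h where h: "j = Suc h" "Suc h < m" using assms by (cases j) auto
  have pos: "0 < Re (1 - c j)" "Im (1 - c j) < 0"
    using False assms Re_interior[of j] Im_pos[of j] by auto
  then have "Arg (1 - c j) < dir h"
    unfolding dir_def h(1) using h by (intro Arg_less_if_cross_neg Re_edge_pos finish_side) auto
  then have "Arg (1 - c j) \<le> dir k" if "k < j" for k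
    using dir_antimono[of k h] h that by auto
  moreover have "\<bar>Arg (1 - c j)\<bar> < pi / 2" "Arg (1 - c j) \<le> 0"
    using pos Arg_Re_pos[of "1 - c j"] Arg_neg_iff[of "1 - c j"] by (auto intro: less_imp_le)
  ultimately show ?thesis
    using that[of "norm (1 - c j)" "- Arg (1 - c j)"] norm_scaleR_cis_Arg[of "1 - c j"] by auto
qed

lemma len_le:
  assumes "i < j" "j \<le> m"
  shows "len i j \<le> 2 * pi / 3 * dist (c i) (c j)"
proof -
  have "i < m" "0 < j" using assms by auto
  obtain a \<alpha> where a: "0 \<le> a" "0 \<le> \<alpha>" "\<alpha> \<le> pi / 2" "0 < a \<Longrightarrow> \<alpha> < pi / 2"
    "c i = a *\<^sub>R cis \<alpha>" "\<And>k. i \<le> k \<Longrightarrow> k < m \<Longrightarrow> dir k \<le> \<alpha>"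
    by (rule direction_from_start[OF \<open>i < m\<close>]) blast
  obtain s \<beta> where s: "0 \<le> s" "0 \<le> \<beta>" "\<beta> \<le> pi / 2" "0 < s \<Longrightarrow> \<beta> < pi / 2"
    "1 - c j = s *\<^sub>R cis (- \<beta>)" "\<And>k. k < j \<Longrightarrow> - \<beta> \<le> dir k"
    by (rule direction_to_finish[OF \<open>0 < j\<close> assms(2)]) blast
  \<comment> \<open>Replacing the outer parts by segments only shortens the chain, so the length
    bounds survive.\<close>
  have "a \<le> len 0 i" using dist_le_len[of 0 i] a by (simp add: start dist_norm)
  have "s \<le> len j m" using dist_le_len[of j m] assms s
    by (simp add: finish dist_norm norm_minus_commute[of "c j"])
  have D: "1 - a *\<^sub>R cis \<alpha> - s *\<^sub>R cis (- \<beta>) = c j - c i"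
    using a(5) s(5) by (simp add: algebra_simps)
  have "len i j \<le> 2 * pi / 3 * norm (1 - a *\<^sub>R cis \<alpha> - s *\<^sub>R cis (- \<beta>))"
  proof (rule middle_bound)
    have "len 0 j = len 0 i + len i j" "len i m = len i j + len j m"
      "len 0 m = len 0 i + len i j + len j m"
      using assms by (simp_all add: len_add)
    then show "a + len i j \<le> 1 + \<beta> - s" "len i j + s \<le> 1 + \<alpha> - a"
      "a + len i j + s \<le> 2 * pi / 3"
      using len_from_start[of j s \<beta>] len_to_finish[of i a \<alpha>] len_total assms a s
        \<open>a \<le> len 0 i\<close> \<open>s \<le> len j m\<close> by auto
  next
    fix n assume n: "1 \<le> cis \<alpha> \<bullet> n" "1 \<le> cis (- \<beta>) \<bullet> n"
    show "len i j \<le> (1 - a *\<^sub>R cis \<alpha> - s *\<^sub>R cis (- \<beta>)) \<bullet> n"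
      unfolding D
    proof (rule len_le_inner)
      fix k assume k: "i \<le> k" "k < j"
      show "1 \<le> cis (dir k) \<bullet> n"
      proof (cases "\<alpha> + \<beta> < pi")
        case True
        with n show ?thesis using k a(6)[of k] s(6)[of k] assms
          by - (rule inner_cis_sector_ge_1[of "- \<beta>" _ \<alpha>]; simp)
      next
        \<comment> \<open>Both angles are right, and the conditions on \<open>n\<close> contradict
          each other.\<close>
        case False
        then have "\<alpha> = pi / 2" "\<beta> = pi / 2" using a s by auto
        with n show ?thesis by (simp add: inner_complex_def)
      qed
    qed (use assms in auto)
  qed (use a s in auto)
  then show ?thesis unfolding D by (simp add: dist_norm norm_minus_commute)
qed

end

section \<open>Reduction to the normal form and conclusion\<close>

lemma nth_in_chain_set:
  assumes "2 \<le> length c" "k < length c"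
  shows "c ! k \<in> chain_set c"
proof (cases "k < length c - 1")
  case True
  then show ?thesis unfolding chain_set_def by force
next
  case False
  then have k: "k - 1 < length c - 1" "Suc (k - 1) = k" using assms by auto
  then have "c ! k \<in> closed_segment (c ! (k - 1)) (c ! Suc (k - 1))" by simp
  then show ?thesis using k(1) unfolding chain_set_def by blast
qed

lemma subchain_length_le:
  fixes c :: "complex list"
  assumes len: "2 \<le> length c" and convex: "convex_chain c"
    and lune: "chain_set c \<subseteq> lune (hd c) (last c)" and "i < j" "j < length c"
  shows "subchain_length c i j \<le> 2 * pi / 3 * dist (c ! i) (c ! j)"
proof -
  define p q m where "p = hd c" "q = last c" "m = length c - 1"
  have ends: "c ! 0 = p" "c ! m = q" and n: "length c = Suc m" "0 < m"
    using len by (cases "c = []"; auto simp: p_q_m_def hd_conv_nth last_conv_nth)+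
  have "distinct c" using convex by (simp add: convex_chain_def)
  then have "p \<noteq> q" using n ends by (metis lessI nat_neq_iff nth_eq_iff_index_eq zero_less_Suc)
  obtain s :: real where s: "s = 1 \<or> s = - 1"
    and side: "\<And>i k. i < Suc m \<Longrightarrow> k < Suc m \<Longrightarrow> k \<noteq> i \<Longrightarrow> k \<noteq> Suc i mod Suc m \<Longrightarrow>
      s * cross (c ! (Suc i mod Suc m) - c ! i) (c ! k - c ! i) > 0"
    using convex unfolding convex_chain_def n by blast
  \<comment> \<open>The similarity taking pq to the unit segment, composed with a reflection if the
    polygon is counterclockwise (\<open>s = 1\<close>).\<close>
  define h where "h = (\<lambda>z. if s = 1 then cnj (z / (q - p)) else z / (q - p))"
  have h_diff: "h a - h b = h (a - b)" for a b by (simp add: h_def diff_divide_distrib)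
  have norm_h: "norm (h a) = norm a / dist p q" for a
    by (simp add: h_def norm_divide dist_norm norm_minus_commute del: complex_cnj_divide)
  have cross_h: "cross (h a) (h b) = - s * cross a b / (dist p q)\<^sup>2" for a b
  proof -
    have cross_div: "cross (a / w) (b / w) = cross a b / (norm w)\<^sup>2" if "w \<noteq> 0" for w
    proof -
      have "cross (a * v) (b * v) = cross a b * (norm v)\<^sup>2" for v
        unfolding cmod_power2 by (simp add: cross_def power2_eq_square algebra_simps)
      from this[of "inverse w"] show ?thesis
        by (simp add: divide_inverse norm_inverse power_inverse)
    qed
    have cross_cnj: "cross (cnj u) (cnj v) = - cross u v" for u v by (simp add: cross_def)
    have "q - p \<noteq> 0" "norm (q - p) = dist p q"
      using \<open>p \<noteq> q\<close> by (simp_all add: dist_norm norm_minus_commute)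
    then have "cross (a / (q - p)) (b / (q - p)) = cross a b / (dist p q)\<^sup>2"
      using cross_div[of "q - p"] by simp
    then show ?thesis using s unfolding h_def by (auto simp: cross_cnj simp del: complex_cnj_divide)
  qed
  define C where "C = (\<lambda>k. h (c ! k - p))"
  have C_diff: "C k - C l = h (c ! k - c ! l)" for k l by (simp add: C_def h_diff)
  have C_side: "cross (C (Suc i mod Suc m) - C i) (C k - C i) < 0"
    if "i < Suc m" "k < Suc m" "k \<noteq> i" "k \<noteq> Suc i mod Suc m" for i k
    using side[OF that] \<open>p \<noteq> q\<close> unfolding C_diff cross_h
    by (simp add: divide_less_0_iff)
  have C_ends: "C 0 = 0" "C m = 1" using \<open>p \<noteq> q\<close> by (auto simp: C_def h_def ends)
  have in_lune: "c ! k \<in> lune p q" if "k \<le> m" for k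
  proof -
    have "c ! k \<in> chain_set c" using nth_in_chain_set[OF len] that n by simp
    then show ?thesis using lune unfolding p_q_m_def(1,2) by blast
  qed
  interpret unit_lune_chain C m
  proof
    show "C 0 = 0" "C m = 1" by (fact C_ends)+
    fix k
    show "norm (C k) \<le> 1" if "k \<le> m"
      using in_lune[OF that] by (simp add: C_def norm_h lune_def dist_norm norm_minus_commute divide_le_eq_1)
    show "norm (C k - 1) \<le> 1" if "k \<le> m"
      using in_lune[OF that] unfolding C_ends(2)[symmetric] C_diff
      by (simp add: norm_h ends lune_def dist_norm norm_minus_commute divide_le_eq_1)
    \<comment> \<open>The closing edge from q back to p, index \<open>m\<close> in the cyclic order,
      puts the chain above pq.\<close>
    show "0 < Im (C k)" if "0 < k" "k < m"
      using C_side[of m k] that by (simp add: C_ends cross_def)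
    show "cross (C k) (C (Suc k) - C k) < 0" if "0 < k" "k < m"
      using C_side[of k 0] that by (simp add: C_ends cross_def algebra_simps)
    show "cross (C (Suc k) - C k) (1 - C (Suc k)) < 0" if "Suc k < m"
      using C_side[of k m] that by (simp add: C_ends cross_def algebra_simps)
    show "cross (C (Suc k) - C k) (C (Suc (Suc k)) - C (Suc k)) < 0" if "Suc k < m"
      using C_side[of k "Suc (Suc k)"] that by (simp add: cross_def algebra_simps)
  qed
  have dist_C: "dist (C k) (C l) = dist (c ! k) (c ! l) / dist p q" for k l
    by (simp add: dist_norm[of "C k"] C_diff norm_h) (simp add: dist_norm)
  have "subchain_length c i j / dist p q \<le> 2 * pi / 3 * (dist (c ! i) (c ! j) / dist p q)"
    using len_le[OF \<open>i < j\<close>] \<open>j < length c\<close> n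
    by (simp add: len_def subchain_length_def dist_C flip: sum_divide_distrib)
  then show ?thesis using \<open>p \<noteq> q\<close> by (simp add: field_simps)
qed

theorem theorem4:
  fixes c :: "complex list"
  assumes "length c \<ge> 2"
    and "convex_chain c"
    and "chain_set c \<subseteq> lune (hd c) (last c)"
  shows "stretch_factor c \<le> 2 * pi / 3"
  unfolding stretch_factor_def
proof (rule cInf_lower)
  have "distinct c" "0 < length c" "1 < length c"
    using assms(1,2) by (auto simp: convex_chain_def)
  then have "c ! 0 \<noteq> c ! 1" using nth_eq_iff_index_eq[of c 0 1] by simp
  \<comment> \<open>The infimum is controlled only for a set bounded below; the first edge, of
    nonzero length, supplies the bound 1.\<close>
  then have "1 \<le> t" if "subchain_length c 0 1 \<le> t * dist (c ! 0) (c ! 1)" for t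
    using that by (simp add: subchain_length_def)
  then show "bdd_below {t. \<forall>i j. i < j \<and> j < length c \<longrightarrow>
      subchain_length c i j \<le> t * dist (c ! i) (c ! j)}"
    using assms(1) by (intro bdd_belowI[of _ 1]) force
qed (use assms subchain_length_le in auto)

end
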